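(* For every positive integer $k$, the circular chromatic number of the signed projective cube satisfies $\chi_c(SPC(k))=4$.
   Context: A signed graph is a graph with a sign $+$ or $-$ on each edge (at most one edge of each sign between two vertices). The signed projective cube $SPC(k)$ is the signed graph with vertex set $\mathbb{Z}_2^k$ in which $x,y$ are joined by a positive edge iff $x-y\in\{e_1,\dots,e_k\}$ (the standard basis) and by a negative edge iff $x-y=J$ (the all-ones vector); $SPC(1)$ is a digon (a positive and a negative edge between two vertices). For a real $r>0$, a circular $r$-coloring of a signed graph $(G,\sigma)$ is a mapping $\phi$ from $V(G)$ to a circle $C$ of circumference $r$ such that for every negative edge $uv$ the distance along $C$ between $\phi(u)$ and $\phi(v)$ is at least $1$, and for every positive edge $xy$ the distance between $\phi(x)$ and $\phi(y)$ is at most $\frac{r}{2}-1$. The circular chromatic number $\chi_c(G,\sigma)$ is the smallest $r$ for which a circular $r$-coloring exists. *)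

theory Defs
  imports Complex_Main "HOL-Library.Z2"
begin

record 'a sgraph =
  verts :: "'a set"
  pos_edges :: "'a set set"
  neg_edges :: "'a set set"

definition signed_graph :: "'a sgraph \<Rightarrow> bool" where
  "signed_graph G \<longleftrightarrow>
     (\<forall>e \<in> pos_edges G \<union> neg_edges G. \<exists>u\<in>verts G. \<exists>v\<in>verts G. u \<noteq> v \<and> e = {u, v})"

text \<open>The group $\mathbb{Z}_2^k$ is represented by the functions \<^typ>\<open>nat \<Rightarrow> bit\<close>
  vanishing outside \<open>{0,...,k-1}\<close>, so coordinates are numbered from 0; \<^typ>\<open>bit\<close> is the
  two-element field.\<close>

definition Z2_pow :: "nat \<Rightarrow> (nat \<Rightarrow> bit) set" where
  "Z2_pow k = {x. \<forall>i\<ge>k. x i = 0}"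

definition diff_vec :: "(nat \<Rightarrow> bit) \<Rightarrow> (nat \<Rightarrow> bit) \<Rightarrow> (nat \<Rightarrow> bit)" where
  "diff_vec x y = (\<lambda>i. x i - y i)"

definition unit_vec :: "nat \<Rightarrow> (nat \<Rightarrow> bit)" where
  "unit_vec i = (\<lambda>j. if j = i then 1 else 0)"

definition all_ones :: "nat \<Rightarrow> (nat \<Rightarrow> bit)" where
  "all_ones k = (\<lambda>j. if j < k then 1 else 0)"

definition SPC :: "nat \<Rightarrow> (nat \<Rightarrow> bit) sgraph" where
  "SPC k = \<lparr>
     verts = Z2_pow k,
     pos_edges = {{x, y} | x y. x \<in> Z2_pow k \<and> y \<in> Z2_pow k \<and> diff_vec x y \<in> unit_vec ` {..<k}},
     neg_edges = {{x, y} | x y. x \<in> Z2_pow k \<and> y \<in> Z2_pow k \<and> diff_vec x y = all_ones k}\<rparr>"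

lemma signed_graph_SPC:
  assumes "k \<ge> 1"
  shows "signed_graph (SPC k)"
proof -
  have "diff_vec x x \<notin> unit_vec ` {..<k}" for x
  proof
    assume "diff_vec x x \<in> unit_vec ` {..<k}"
    then obtain i where "diff_vec x x i = unit_vec i i" by auto
    then show False by (simp add: diff_vec_def unit_vec_def)
  qed
  moreover have "diff_vec x x \<noteq> all_ones k" for x
    using assms by (auto simp: diff_vec_def all_ones_def dest!: fun_cong[of _ _ 0])
  ultimately show ?thesis
    unfolding signed_graph_def SPC_def by fastforce
qed

text \<open>The circle of circumference \<open>r\<close> is the interval \<open>[0,r)\<close>, i.e. \<open>[0,r]\<close> with its
  endpoints identified; the distance of two points is the length of the shorter arc.\<close>

definition circle_dist :: "real \<Rightarrow> real \<Rightarrow> real \<Rightarrow> real" where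
  "circle_dist r s t = min \<bar>s - t\<bar> (r - \<bar>s - t\<bar>)"

definition circular_coloring :: "'a sgraph \<Rightarrow> real \<Rightarrow> ('a \<Rightarrow> real) \<Rightarrow> bool" where
  "circular_coloring G r \<phi> \<longleftrightarrow>
     \<phi> ` verts G \<subseteq> {0..<r} \<and>
     (\<forall>u v. {u, v} \<in> neg_edges G \<longrightarrow> circle_dist r (\<phi> u) (\<phi> v) \<ge> 1) \<and>
     (\<forall>x y. {x, y} \<in> pos_edges G \<longrightarrow> circle_dist r (\<phi> x) (\<phi> y) \<le> r / 2 - 1)"

definition circular_colorable :: "'a sgraph \<Rightarrow> real \<Rightarrow> bool" where
  "circular_colorable G r \<longleftrightarrow> r > 0 \<and> (\<exists>\<phi>. circular_coloring G r \<phi>)"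

text \<open>The circular chromatic number is a minimum. It is introduced as a relation, so that
  having circular chromatic number \<open>r\<close> includes that the minimum exists.\<close>

definition has_circular_chromatic_number :: "'a sgraph \<Rightarrow> real \<Rightarrow> bool" where
  "has_circular_chromatic_number G r \<longleftrightarrow>
     circular_colorable G r \<and> (\<forall>s. circular_colorable G s \<longrightarrow> r \<le> s)"

lemma has_circular_chromatic_number_unique:
  "has_circular_chromatic_number G r \<Longrightarrow> has_circular_chromatic_number G s \<Longrightarrow> r = s"
  unfolding has_circular_chromatic_number_def by (meson order_antisym)

end

(* A circular r-coloring of the cube with r < 4 moves by at most r/2 - 1 along a positive edge, so by
   less than r around any 4-cycle; hence it lifts to a map f from the cube to the real line. The
   displacement g(x) = f(x+J) - f(x) stays at distance at least 1 from the multiples of r and changes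
   by at most r - 2 < 2 along an edge, so it remains in one gap between two consecutive multiples
   of r. This contradicts g(x+J) = -g(x). The lift is built by induction on the dimension, gluing two
   facets by the same discrete continuity argument. *)
theory Submission
  imports Defs
begin

section \<open>Lifting from the circle to the real line over a cube\<close>

lemma abs_int_mult_less_imp_eq_0:
  fixes n :: int and r :: real
  assumes "\<bar>n * r\<bar> < r"
  shows "n = 0"
proof -
  have "0 < r"
    using assms abs_ge_zero[of "n * r"] by linarith
  with assms have "\<bar>real_of_int n\<bar> < 1"
    by (simp add: abs_mult)
  then show ?thesis
    by linarith
qed

text \<open>Discrete continuity on the cube whose vertices are the subsets of \<open>K\<close>: the
  multiples of \<open>r\<close> near the values at two adjacent vertices differ by at most
  \<open>\<delta> + 2 * \<delta> + \<delta> < r\<close>, hence coincide.\<close>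

lemma nearest_multiple_constant:
  fixes h :: "'a set \<Rightarrow> real" and r \<delta> :: real and m :: int
  assumes "finite K" "4 * \<delta> < r"
    and near: "\<And>A. A \<subseteq> K \<Longrightarrow> \<exists>n::int. \<bar>h A - n * r\<bar> \<le> \<delta>"
    and step: "\<And>A i. A \<subseteq> K \<Longrightarrow> i \<in> K \<Longrightarrow> i \<notin> A \<Longrightarrow> \<bar>h (insert i A) - h A\<bar> \<le> 2 * \<delta>"
    and start: "\<bar>h {} - m * r\<bar> \<le> \<delta>"
    and "A \<subseteq> K"
  shows "\<bar>h A - m * r\<bar> \<le> \<delta>"
proof -
  have "finite A"
    using assms(1,6) by (rule rev_finite_subset)
  then show ?thesis
    using \<open>A \<subseteq> K\<close>
  proof (induction A rule: finite_subset_induct')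
    case empty
    show ?case by (rule start)
  next
    case (insert i A)
    obtain n :: int where n: "\<bar>h (insert i A) - n * r\<bar> \<le> \<delta>"
      using near[of "insert i A"] insert.hyps by auto
    have "\<bar>(n - m) * r\<bar> \<le> 4 * \<delta>"
      using n insert.IH step[of A i] insert.hyps by (simp add: left_diff_distrib)
    then have "n = m"
      using abs_int_mult_less_imp_eq_0[of "n - m" r] \<open>4 * \<delta> < r\<close> by simp
    then show ?case
      using n by simp
  qed
qed

text \<open>Here \<open>c\<close> chooses real representatives of a circle-valued map, and
  \<open>f\<close> chooses them anew modulo \<open>r\<close> so that edge steps are small as real
  numbers. The facets without and with \<open>a\<close> are lifted separately, to \<open>f0\<close>
  and \<open>f1\<close>; one common multiple of \<open>r\<close> corrects the mismatch between
  them.\<close>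

lemma cube_lift:
  fixes c :: "'a set \<Rightarrow> real" and r \<delta> :: real
  assumes "finite K" "4 * \<delta> < r"
    and "\<And>A i. A \<subseteq> K \<Longrightarrow> i \<in> K \<Longrightarrow> i \<notin> A \<Longrightarrow> \<exists>n::int. \<bar>c (insert i A) - c A - n * r\<bar> \<le> \<delta>"
  shows "\<exists>f. (\<forall>A\<subseteq>K. \<exists>n::int. f A = c A + n * r) \<and>
    (\<forall>A i. A \<subseteq> K \<longrightarrow> i \<in> K \<longrightarrow> i \<notin> A \<longrightarrow> \<bar>f (insert i A) - f A\<bar> \<le> \<delta>)"
  using assms(1,3)
proof (induction K arbitrary: c rule: finite_induct)
  case empty
  show ?case by (rule exI[of _ c]) (auto intro: exI[of _ 0])
next
  case (insert a K)
  have cstep: "\<exists>n::int. \<bar>c (insert i A) - c A - n * r\<bar> \<le> \<delta>"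
    if "A \<subseteq> insert a K" "i \<in> insert a K" "i \<notin> A" for A i
    using insert.prems that by blast
  let ?lift = "\<lambda>c f. (\<forall>A\<subseteq>K. \<exists>n::int. f A = c A + n * r) \<and>
    (\<forall>A i. A \<subseteq> K \<longrightarrow> i \<in> K \<longrightarrow> i \<notin> A \<longrightarrow> \<bar>f (insert i A) - f A\<bar> \<le> \<delta>)"
  have "\<exists>f. ?lift c f"
    by (rule insert.IH, rule cstep) auto
  then obtain f0 where f0: "\<And>A. A \<subseteq> K \<Longrightarrow> \<exists>n::int. f0 A = c A + n * r"
    and f0_step: "\<And>A i. A \<subseteq> K \<Longrightarrow> i \<in> K \<Longrightarrow> i \<notin> A \<Longrightarrow> \<bar>f0 (insert i A) - f0 A\<bar> \<le> \<delta>"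
    by blast
  have "\<exists>f. ?lift (\<lambda>A. c (insert a A)) f"
  proof (rule insert.IH)
    fix A i assume "A \<subseteq> K" "i \<in> K" "i \<notin> A"
    then show "\<exists>n::int. \<bar>c (insert a (insert i A)) - c (insert a A) - n * r\<bar> \<le> \<delta>"
      using cstep[of "insert a A" i] insert.hyps by (auto simp: insert_commute)
  qed
  then obtain f1 where f1: "\<And>A. A \<subseteq> K \<Longrightarrow> \<exists>n::int. f1 A = c (insert a A) + n * r"
    and f1_step: "\<And>A i. A \<subseteq> K \<Longrightarrow> i \<in> K \<Longrightarrow> i \<notin> A \<Longrightarrow> \<bar>f1 (insert i A) - f1 A\<bar> \<le> \<delta>"
    by blast
  have near: "\<exists>n::int. \<bar>f1 A - f0 A - n * r\<bar> \<le> \<delta>" if A: "A \<subseteq> K" for A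
  proof -
    obtain p q n :: int where "f0 A = c A + p * r" "f1 A = c (insert a A) + q * r"
      "\<bar>c (insert a A) - c A - n * r\<bar> \<le> \<delta>"
      using f0[OF A] f1[OF A] cstep[of A a] A insert.hyps by blast
    then have "\<bar>f1 A - f0 A - (n + q - p) * r\<bar> \<le> \<delta>"
      by (simp add: algebra_simps)
    then show ?thesis
      by blast
  qed
  obtain m :: int where m: "\<bar>f1 {} - f0 {} - m * r\<bar> \<le> \<delta>"
    using near[of "{}"] by auto
  \<comment> \<open>Each lift moves by at most \<open>\<delta>\<close> along an edge of its facet,
    so the difference moves by at most \<open>2 * \<delta>\<close> and keeps the multiple found at
    the empty set.\<close>
  have cross: "\<bar>f1 A - f0 A - m * r\<bar> \<le> \<delta>" if "A \<subseteq> K" for A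
  proof (rule nearest_multiple_constant[where h = "\<lambda>A. f1 A - f0 A", OF insert.hyps(1) assms(2) near _ m that])
    fix A i assume "A \<subseteq> K" "i \<in> K" "i \<notin> A"
    then show "\<bar>f1 (insert i A) - f0 (insert i A) - (f1 A - f0 A)\<bar> \<le> 2 * \<delta>"
      using f0_step[of A i] f1_step[of A i] by linarith
  qed
  \<comment> \<open>Subtracting \<open>m * r\<close> preserves congruence and the steps inside the
    facet, and turns \<open>cross\<close> into the bound for edges in direction
    \<open>a\<close>.\<close>
  define f where "f A = (if a \<in> A then f1 (A - {a}) - m * r else f0 A)" for A
  have "\<exists>n::int. f A = c A + n * r" if A: "A \<subseteq> insert a K" for A
  proof (cases "a \<in> A")
    case True
    then obtain n :: int where "f1 (A - {a}) = c A + n * r"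
      using f1[of "A - {a}"] A by (auto simp: insert_absorb)
    then have "f A = c A + (n - m) * r"
      using True by (simp add: f_def algebra_simps)
    then show ?thesis
      by blast
  next
    case False
    then show ?thesis
      using f0[of A] A by (auto simp: f_def)
  qed
  moreover have "\<bar>f (insert i A) - f A\<bar> \<le> \<delta>"
    if A: "A \<subseteq> insert a K" and i: "i \<in> insert a K" "i \<notin> A" for A i
  proof (cases "i = a")
    case True
    then show ?thesis
      using cross[of A] A i by (auto simp: f_def algebra_simps)
  next
    case False
    have "insert i A - {a} = insert i (A - {a})"
      using False by auto
    then show ?thesis
      using False A i f0_step[of A i] f1_step[of "A - {a}" i] by (auto simp: f_def)
  qed
  ultimately show ?case
    by blast
qed

text \<open>The lower bound in terms of subsets, with antipodes as complements. The condition
  \<open>r < 4\<close> is exactly \<open>4 * (r / 2 - 1) < r\<close>, as lifting and discrete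
  continuity require.\<close>

lemma cube_no_antipodal_gap:
  fixes c :: "'a set \<Rightarrow> real" and r :: real
  assumes "finite K" "r < 4"
    and edge: "\<And>A i. A \<subseteq> K \<Longrightarrow> i \<in> K \<Longrightarrow> i \<notin> A \<Longrightarrow> \<exists>n::int. \<bar>c (insert i A) - c A - n * r\<bar> \<le> r / 2 - 1"
    and anti: "\<And>A. A \<subseteq> K \<Longrightarrow> \<exists>n::int. \<bar>c (K - A) - c A - r / 2 - n * r\<bar> \<le> r / 2 - 1"
  shows False
proof -
  define \<delta> where "\<delta> = r / 2 - 1"
  have \<delta>: "4 * \<delta> < r"
    using assms by (simp add: \<delta>_def)
  obtain f where f: "\<And>A. A \<subseteq> K \<Longrightarrow> \<exists>n::int. f A = c A + n * r"
    and f_step: "\<And>A i. A \<subseteq> K \<Longrightarrow> i \<in> K \<Longrightarrow> i \<notin> A \<Longrightarrow> \<bar>f (insert i A) - f A\<bar> \<le> \<delta>"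
    using cube_lift[of K \<delta> r c, OF assms(1) \<delta> edge[folded \<delta>_def]] by blast
  \<comment> \<open>The shift by \<open>r / 2\<close> carries the midpoints of the gaps between
    multiples of \<open>r\<close> to multiples of \<open>r\<close>, so that
    \<open>nearest_multiple_constant\<close> applies.\<close>
  define g where "g A = f (K - A) - f A - r / 2" for A
  have near: "\<exists>n::int. \<bar>g A - n * r\<bar> \<le> \<delta>" if A: "A \<subseteq> K" for A
  proof -
    obtain p q n :: int where "f A = c A + p * r" "f (K - A) = c (K - A) + q * r"
      "\<bar>c (K - A) - c A - r / 2 - n * r\<bar> \<le> \<delta>"
      using f[OF A] f[of "K - A"] anti[OF A] unfolding \<delta>_def by blast
    then have "\<bar>g A - (n + q - p) * r\<bar> \<le> \<delta>"
      by (simp add: g_def algebra_simps)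
    then show ?thesis
      by blast
  qed
  obtain m :: int where m: "\<bar>g {} - m * r\<bar> \<le> \<delta>"
    using near[of "{}"] by auto
  have "\<bar>g K - m * r\<bar> \<le> \<delta>"
  proof (rule nearest_multiple_constant[where h = g, OF assms(1) \<delta> near _ m order_refl])
    fix A i assume *: "A \<subseteq> K" "i \<in> K" "i \<notin> A"
    \<comment> \<open>Adding \<open>i\<close> to \<open>A\<close> removes it from the complement, so
      \<open>g\<close> changes by two edge steps of \<open>f\<close>.\<close>
    then have "K - A = insert i (K - insert i A)"
      by auto
    then show "\<bar>g (insert i A) - g A\<bar> \<le> 2 * \<delta>"
      using f_step[of A i] f_step[of "K - insert i A" i] * by (auto simp: g_def)
  qed
  moreover have "g K = - g {} - r"
    by (simp add: g_def)
  \<comment> \<open>Both \<open>g {}\<close> and \<open>- g {} - r\<close> lie within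
    \<open>\<delta>\<close> of \<open>m * r\<close>; adding the two bounds gives at most
    \<open>2 * \<delta> = r - 2\<close>. An odd factor cannot vanish.\<close>
  ultimately have "\<bar>(2 * m + 1) * r\<bar> < r"
    using m by (simp add: \<delta>_def algebra_simps abs_if split: if_splits)
  then have "2 * m + 1 = 0"
    using abs_int_mult_less_imp_eq_0[of "2 * m + 1" r] by simp
  then show False
    by presburger
qed

section \<open>Circle distance as closeness modulo \<open>r\<close>\<close>

lemma circle_dist_le_imp_near_multiple:
  assumes "s \<in> {0..<r}" "t \<in> {0..<r}" "circle_dist r s t \<le> \<delta>"
  shows "\<exists>n::int. \<bar>s - t - n * r\<bar> \<le> \<delta>"
proof -
  \<comment> \<open>As \<open>s - t\<close> lies strictly between \<open>-r\<close> and
    \<open>r\<close>, the direct arc needs \<open>0\<close> and the arc through the identified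
    endpoints needs \<open>1\<close> or \<open>-1\<close>.\<close>
  have "\<bar>s - t - of_int 0 * r\<bar> \<le> \<delta> \<or> \<bar>s - t - of_int 1 * r\<bar> \<le> \<delta> \<or> \<bar>s - t - of_int (-1) * r\<bar> \<le> \<delta>"
    using assms by (auto simp: circle_dist_def min_def split: if_splits)
  then show ?thesis
    by blast
qed

text \<open>Being far apart on the circle amounts to being nearly antipodal; this gives negative
  edges the same form as positive ones. The sign of \<open>s - t\<close> decides between the two
  integers.\<close>

lemma circle_dist_ge_imp_near_half_multiple:
  assumes "circle_dist r s t \<ge> d"
  shows "\<exists>n::int. \<bar>s - t - r / 2 - n * r\<bar> \<le> r / 2 - d"
proof -
  have "\<bar>s - t - r / 2 - of_int 0 * r\<bar> \<le> r / 2 - d \<or> \<bar>s - t - r / 2 - of_int (-1) * r\<bar> \<le> r / 2 - d"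
    using assms by (auto simp: circle_dist_def min_def abs_if field_simps split: if_splits)
  then show ?thesis
    by blast
qed

section \<open>Bounds for the signed projective cube\<close>

lemma diff_vec_commute: "diff_vec x y = diff_vec y x"
proof
  show "diff_vec x y i = diff_vec y x i" for i
    by (cases "x i"; cases "y i") (simp_all add: diff_vec_def)
qed

lemma pos_edges_SPC_iff:
  "{x, y} \<in> pos_edges (SPC k) \<longleftrightarrow> x \<in> Z2_pow k \<and> y \<in> Z2_pow k \<and> diff_vec x y \<in> unit_vec ` {..<k}"
  unfolding SPC_def by (auto simp: doubleton_eq_iff diff_vec_commute)

lemma neg_edges_SPC_iff:
  "{x, y} \<in> neg_edges (SPC k) \<longleftrightarrow> x \<in> Z2_pow k \<and> y \<in> Z2_pow k \<and> diff_vec x y = all_ones k"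
  unfolding SPC_def by (auto simp: doubleton_eq_iff diff_vec_commute)

lemma circular_colorable_SPC_ge_4:
  assumes "circular_colorable (SPC k) r"
  shows "4 \<le> r"
proof (rule ccontr)
  assume "\<not> 4 \<le> r"
  then have "r < 4"
    by simp
  obtain \<phi> where \<phi>: "circular_coloring (SPC k) r \<phi>"
    using assms by (auto simp: circular_colorable_def)
  \<comment> \<open>Indicator vectors turn subsets into vertices: inserting an element follows a
    positive edge, complementing a negative one.\<close>
  define v :: "nat set \<Rightarrow> nat \<Rightarrow> bit" where "v A = (\<lambda>i. if i \<in> A then 1 else 0)" for A
  have v: "v A \<in> Z2_pow k" if "A \<subseteq> {..<k}" for A
    using that by (auto simp: v_def Z2_pow_def)
  have "\<phi> ` Z2_pow k \<subseteq> {0..<r}"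
    using \<phi> by (simp add: circular_coloring_def SPC_def)
  then have range: "\<phi> (v A) \<in> {0..<r}" if "A \<subseteq> {..<k}" for A
    using v[OF that] by blast
  show False
  proof (rule cube_no_antipodal_gap[of "{..<k}" r "\<lambda>A. \<phi> (v A)"])
    fix A i assume *: "A \<subseteq> {..<k}" "i \<in> {..<k}" "i \<notin> A"
    have "diff_vec (v (insert i A)) (v A) = unit_vec i"
      using * by (auto simp: diff_vec_def unit_vec_def v_def)
    then have "{v (insert i A), v A} \<in> pos_edges (SPC k)"
      using * v by (auto simp: pos_edges_SPC_iff)
    then show "\<exists>n::int. \<bar>\<phi> (v (insert i A)) - \<phi> (v A) - n * r\<bar> \<le> r / 2 - 1"
      using \<phi> * range by (intro circle_dist_le_imp_near_multiple) (auto simp: circular_coloring_def)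
  next
    fix A assume *: "A \<subseteq> {..<k}"
    have "diff_vec (v ({..<k} - A)) (v A) = all_ones k"
      using * by (auto simp: diff_vec_def all_ones_def v_def fun_eq_iff)
    then have "{v ({..<k} - A), v A} \<in> neg_edges (SPC k)"
      using * v by (auto simp: neg_edges_SPC_iff)
    then show "\<exists>n::int. \<bar>\<phi> (v ({..<k} - A)) - \<phi> (v A) - r / 2 - n * r\<bar> \<le> r / 2 - 1"
      using \<phi> by (intro circle_dist_ge_imp_near_half_multiple) (auto simp: circular_coloring_def)
  qed (use \<open>r < 4\<close> in auto)
qed

text \<open>The four colours 0, 1, 2, 3 suffice: the coordinate sum modulo 2 fixes the parity of the
  colour and flips along positive edges, while coordinate 0 flips along negative edges.\<close>

lemma circular_colorable_SPC_4:
  assumes "k \<ge> 1"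
  shows "circular_colorable (SPC k) 4"
proof -
  define p where "p x = (\<Sum>i<k. x i)" for x :: "nat \<Rightarrow> bit"
  define \<phi> :: "(nat \<Rightarrow> bit) \<Rightarrow> real"
    where "\<phi> x = (if p x = 1 then 1 else 0) + (if x 0 = 1 then 2 else 0)" for x
  \<comment> \<open>On the circle of circumference 4, an even and an odd colour are always
    neighbours; colours of equal parity are equal or antipodal.\<close>
  have near: "circle_dist 4 (\<phi> x) (\<phi> y) = 1" if "p x \<noteq> p y" for x y
    using that by (cases "p x"; cases "p y") (auto simp: \<phi>_def circle_dist_def)
  have far: "circle_dist 4 (\<phi> x) (\<phi> y) = 2" if "p x = p y" "x 0 \<noteq> y 0" for x y
    using that by (cases "x 0"; cases "y 0") (auto simp: \<phi>_def circle_dist_def)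
  have pos: "p x \<noteq> p y" if "{x, y} \<in> pos_edges (SPC k)" for x y
  proof -
    obtain i where "i < k" "diff_vec x y = unit_vec i"
      using \<open>{x, y} \<in> pos_edges (SPC k)\<close> by (auto simp: pos_edges_SPC_iff)
    have "p x - p y = (\<Sum>j<k. diff_vec x y j)"
      unfolding p_def diff_vec_def by (rule sum_subtractf[symmetric])
    also have "\<dots> = (\<Sum>j<k. unit_vec i j)"
      by (simp only: \<open>diff_vec x y = unit_vec i\<close>)
    also have "\<dots> = 1"
      using \<open>i < k\<close> by (simp add: unit_vec_def)
    finally show ?thesis
      by auto
  qed
  have neg: "x 0 \<noteq> y 0" if "{x, y} \<in> neg_edges (SPC k)" for x y
  proof -
    have "diff_vec x y 0 = all_ones k 0"
      using that by (simp add: neg_edges_SPC_iff)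
    then show ?thesis
      using assms by (auto simp: diff_vec_def all_ones_def)
  qed
  have "\<phi> ` verts (SPC k) \<subseteq> {0..<4}"
    by (auto simp: \<phi>_def)
  moreover have "1 \<le> circle_dist 4 (\<phi> x) (\<phi> y)" if "{x, y} \<in> neg_edges (SPC k)" for x y
    using near[of x y] far[of x y] neg[OF that] by (cases "p x = p y") simp_all
  moreover have "circle_dist 4 (\<phi> x) (\<phi> y) \<le> 4 / 2 - 1" if "{x, y} \<in> pos_edges (SPC k)" for x y
    using near[of x y] pos[OF that] by simp
  ultimately have "circular_coloring (SPC k) 4 \<phi>"
    by (simp add: circular_coloring_def)
  then show ?thesis
    by (auto simp: circular_colorable_def)
qed

theorem mainTheorem7:
  fixes k :: nat
  assumes "k \<ge> 1"
  shows "has_circular_chromatic_number (SPC k) 4"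
  using circular_colorable_SPC_4[OF assms] circular_colorable_SPC_ge_4
  by (auto simp: has_circular_chromatic_number_def)

end
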